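(* Let $D$ be the generator of a strongly continuous one-parameter group of isometries $e^{tD}$, $t\in\mathbb{R}$, in a complex Banach space $E$. For every $f\in\mathcal{D}^\infty$ and all integers $0\le k\le n$ with $n\geq 1$, $$\|D^kf\|^n\le C_{k,n}\,\|D^nf\|^k\,\|f\|^{n-k},\qquad C_{k,n}=\frac{(K_{n-k})^n}{(K_n)^{n-k}} .$$
   Context: $\mathcal{D}^k$ denotes the domain of $D^k$ and $\mathcal{D}^\infty=\bigcap_{k\in\mathbb{N}}\mathcal{D}^k$. The Favard constants are $$K_j=\frac{4}{\pi}\sum_{r=0}^\infty\frac{(-1)^{r(j+1)}}{(2r+1)^{j+1}},\qquad j=0,1,2,\dots$$ *)

theory Defs
  imports "HOL-Analysis.Analysis"
begin

text \<open>The scalar multiplication by complex numbers extends the real one of \<^class>\<open>banach\<close>.\<close>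

class complex_banach = banach +
  fixes scaleC :: "complex \<Rightarrow> 'a \<Rightarrow> 'a"  (infixr "*\<^sub>C" 75)
  assumes scaleC_add_right: "c *\<^sub>C (x + y) = c *\<^sub>C x + c *\<^sub>C y"
    and scaleC_add_left: "(c + d) *\<^sub>C x = c *\<^sub>C x + d *\<^sub>C x"
    and scaleC_scaleC: "c *\<^sub>C (d *\<^sub>C x) = (c * d) *\<^sub>C x"
    and scaleC_of_real: "complex_of_real r *\<^sub>C x = r *\<^sub>R x"
    and norm_scaleC: "norm (c *\<^sub>C x) = cmod c * norm x"

instantiation complex :: complex_banach
begin

definition scaleC_complex :: "complex \<Rightarrow> complex \<Rightarrow> complex"
  where "scaleC_complex c x = c * x"

instance
  by standard (simp_all add: scaleC_complex_def algebra_simps norm_mult scaleR_conv_of_real)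

end

lemma vector_space_scaleC: "vector_space (scaleC :: complex \<Rightarrow> 'a::complex_banach \<Rightarrow> 'a)"
proof
  fix x :: 'a
  show "1 *\<^sub>C x = x"
    using scaleC_of_real [of 1 x] by simp
qed (simp_all add: scaleC_add_right scaleC_add_left scaleC_scaleC)

text \<open>By the group law each \<open>U t\<close> is bijective with inverse \<open>U (- t)\<close>, so norm preservation makes
  it a surjective isometry.\<close>

definition C0_isometry_group :: "(real \<Rightarrow> 'a::complex_banach \<Rightarrow> 'a) \<Rightarrow> bool" where
  "C0_isometry_group U \<longleftrightarrow>
     (\<forall>t. Vector_Spaces.linear scaleC scaleC (U t)) \<and>
     (\<forall>t f. norm (U t f) = norm f) \<and>
     (\<forall>f. U 0 f = f) \<and>
     (\<forall>s t f. U (s + t) f = U s (U t f)) \<and>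
     (\<forall>f. continuous_on UNIV (\<lambda>t. U t f))"

text \<open>The generator is a partial operator: a domain together with a total function whose values
  outside the domain are irrelevant.\<close>

definition generator_dom :: "(real \<Rightarrow> 'a::complex_banach \<Rightarrow> 'a) \<Rightarrow> 'a set" where
  "generator_dom U = {f. \<exists>g. ((\<lambda>t. (U t f - f) /\<^sub>R t) \<longlongrightarrow> g) (at 0)}"

definition generator :: "(real \<Rightarrow> 'a::complex_banach \<Rightarrow> 'a) \<Rightarrow> 'a \<Rightarrow> 'a" where
  "generator U f = Lim (at 0) (\<lambda>t. (U t f - f) /\<^sub>R t)"

primrec power_dom :: "'a set \<Rightarrow> ('a \<Rightarrow> 'a) \<Rightarrow> nat \<Rightarrow> 'a set" where
  "power_dom X A 0 = UNIV"
| "power_dom X A (Suc k) = {f \<in> power_dom X A k. (A ^^ k) f \<in> X}"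

definition smooth_dom :: "'a set \<Rightarrow> ('a \<Rightarrow> 'a) \<Rightarrow> 'a set" where
  "smooth_dom X A = (\<Inter>k. power_dom X A k)"

text \<open>For \<open>j = 0\<close> the series converges only conditionally, so it has to be the ordered sum
  \<^const>\<open>suminf\<close>.\<close>

definition favard :: "nat \<Rightarrow> real" where
  "favard j = 4 / pi * (\<Sum>r. (-1) ^ (r * (j + 1)) / real (2 * r + 1) ^ (j + 1))"

end

theory Submission
  imports Defs
begin

text \<open>Since \<open>D f\<close> is again smooth, it suffices to bound the first power: if
  \<open>\<parallel>f\<parallel> \<le> a K\<^sub>n l\<^sup>n\<close> and \<open>\<parallel>D\<^sup>n f\<parallel> \<le> a\<close>, then \<open>\<parallel>D f\<parallel> \<le> a K\<^bsub>n-1\<^esub> l\<^bsup>n-1\<^esup>\<close>; iterating this and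
  choosing \<open>l\<close> gives the product inequality. A norming functional applied to the orbit of \<open>f\<close> turns
  this into a statement on scalar functions \<open>g\<close> with \<open>\<bar>g\<bar> \<le> K\<^sub>n\<close> and \<open>\<bar>g\<^bsup>(n)\<^esup>\<bar> \<le> 1\<close>, which are compared
  with the Euler spline, an \<open>n\<close>-fold antiderivative of the square wave \<open>sgn sin\<close> with maximum \<open>K\<^sub>n\<close>.
  If \<open>g'\<close> exceeded \<open>K\<^bsub>n-1\<^esub>\<close>, a translate of \<open>g\<close>, cut off to decay at infinity, would differ from the
  spline by a function with two more sign changes than the spline. Sign changes survive
  differentiation by the mean value theorem, so after \<open>n\<close> steps the square wave itself would have
  two sign changes too many.\<close>

section \<open>Norming functionals\<close>

text \<open>An inequality suffices for homogeneity, since scaling back by \<open>1 / c\<close> gives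
  the converse. Domination by the norm is built in because it keeps chains bounded below.\<close>

definition sublinear :: "('a::real_normed_vector \<Rightarrow> real) \<Rightarrow> bool" where
  "sublinear p \<longleftrightarrow> (\<forall>x y. p (x + y) \<le> p x + p y) \<and> (\<forall>c x. 0 \<le> c \<longrightarrow> p (c *\<^sub>R x) \<le> c * p x) \<and>
     (\<forall>x. p x \<le> norm x)"

lemma sublinear_norm: "sublinear norm"
  by (simp add: sublinear_def norm_triangle_ineq)

lemma
  assumes "sublinear p"
  shows sublinear_add: "p (x + y) \<le> p x + p y"
    and sublinear_scaleR: "0 \<le> c \<Longrightarrow> p (c *\<^sub>R x) \<le> c * p x"
    and sublinear_le_norm: "p x \<le> norm x"
  using assms by (auto simp: sublinear_def)

lemma sublinear_zero:
  assumes "sublinear p"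
  shows "p 0 = 0"
  using sublinear_add [OF assms, of 0 0] sublinear_scaleR [OF assms, of 0 0] by simp

lemma sublinear_ge:
  assumes "sublinear p"
  shows "- norm x \<le> p x"
  using sublinear_add [OF assms, of x "- x"] sublinear_zero [OF assms]
    sublinear_le_norm [OF assms, of "- x"] by simp

text \<open>Tilting lowers a sublinear functional while making it additive along \<open>y\<close>; a minimal
  sublinear functional equals all its tilts and is therefore linear.\<close>

definition tilt :: "('a::real_normed_vector \<Rightarrow> real) \<Rightarrow> 'a \<Rightarrow> 'a \<Rightarrow> real" where
  "tilt p y x = (INF t\<in>{0..}. p (x + t *\<^sub>R y) - t * p y)"

lemma tilt_le:
  assumes "sublinear p" "0 \<le> t"
  shows "tilt p y x \<le> p (x + t *\<^sub>R y) - t * p y"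
proof -
  have "bdd_below ((\<lambda>t. p (x + t *\<^sub>R y) - t * p y) ` {0..})"
  proof (rule bdd_belowI2)
    fix t :: real assume t: "t \<in> {0..}"
    have "p (x + t *\<^sub>R y) + p (t *\<^sub>R y - (x + t *\<^sub>R y)) \<ge> p (t *\<^sub>R y)"
      using sublinear_add [OF assms(1), of "x + t *\<^sub>R y" "t *\<^sub>R y - (x + t *\<^sub>R y)"] by simp
    moreover have "p (t *\<^sub>R y) = t * p y"
    proof (cases "t = 0")
      case False
      then show ?thesis
        using t sublinear_scaleR [OF assms(1), of t y] sublinear_scaleR [OF assms(1), of "1 / t" "t
            *\<^sub>R y"]
        by (simp add: field_simps)
    qed (simp add: sublinear_zero [OF assms(1)])
    ultimately show "- p (- x) \<le> p (x + t *\<^sub>R y) - t * p y"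
      by simp
  qed
  then show ?thesis
    unfolding tilt_def using assms(2) by (intro cINF_lower) auto
qed

lemma tilt_greatest:
  assumes "\<And>t. 0 \<le> t \<Longrightarrow> m \<le> p (x + t *\<^sub>R y) - t * p y"
  shows "m \<le> tilt p y x"
  unfolding tilt_def using assms by (intro cINF_greatest) auto

lemma sublinear_tilt:
  assumes p: "sublinear p"
  shows "sublinear (tilt p y)"
  unfolding sublinear_def
proof (intro conjI allI impI)
  fix x z
  \<comment> \<open>The parameters \<open>t\<close> for \<open>x\<close> and \<open>s\<close> for
    \<open>z\<close> add up to an admissible one for \<open>x + z\<close>; the infimum is taken over
    \<open>t\<close> first, then over \<open>s\<close>.\<close>
  have "tilt p y (x + z) - (p (z + s *\<^sub>R y) - s * p y) \<le> tilt p y x" if "0 \<le> s" for s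
  proof (rule tilt_greatest)
    fix t :: real assume "0 \<le> t"
    then show "tilt p y (x + z) - (p (z + s *\<^sub>R y) - s * p y) \<le> p (x + t *\<^sub>R y) - t * p y"
      using tilt_le [OF p, of "t + s" y "x + z"] that
        sublinear_add [OF p, of "x + t *\<^sub>R y" "z + s *\<^sub>R y"]
      by (simp add: algebra_simps)
  qed
  then have "tilt p y (x + z) - tilt p y x \<le> tilt p y z"
    by (intro tilt_greatest) (simp add: algebra_simps)
  then show "tilt p y (x + z) \<le> tilt p y x + tilt p y z"
    by simp
next
  fix c x assume c: "0 \<le> (c::real)"
  show "tilt p y (c *\<^sub>R x) \<le> c * tilt p y x"
  proof (cases "c = 0")
    case True
    then show ?thesis
      using tilt_le [OF p, of 0 y 0] by (simp add: sublinear_zero [OF p])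
  next
    case False
    with c have "0 < c" by simp
    have "tilt p y (c *\<^sub>R x) / c \<le> tilt p y x"
    proof (rule tilt_greatest)
      fix t :: real assume "0 \<le> t"
      then have "tilt p y (c *\<^sub>R x) \<le> p (c *\<^sub>R x + (c * t) *\<^sub>R y) - c * t * p y"
        using tilt_le [OF p, of "c * t" y "c *\<^sub>R x"] \<open>0 < c\<close> by simp
      also have "p (c *\<^sub>R x + (c * t) *\<^sub>R y) \<le> c * p (x + t *\<^sub>R y)"
        using sublinear_scaleR [OF p c, of "x + t *\<^sub>R y"] by (simp add: algebra_simps)
      finally show "tilt p y (c *\<^sub>R x) / c \<le> p (x + t *\<^sub>R y) - t * p y"
        using \<open>0 < c\<close> by (simp add: field_simps)
    qed
    then show ?thesis
      using \<open>0 < c\<close> by (simp add: field_simps)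
  qed
next
  fix x
  show "tilt p y x \<le> norm x"
    using tilt_le [OF p, of 0 y x] sublinear_le_norm [OF p, of x] by simp
qed

text \<open>Zorn's lemma for the reversed pointwise order: the pointwise infimum of a nonempty chain
  is again sublinear, and \<open>p0\<close> bounds the empty chain.\<close>

lemma minimal_sublinear_exists:
  fixes p0 :: "'a::real_normed_vector \<Rightarrow> real"
  assumes "sublinear p0"
  obtains p where "sublinear p" "p \<le> p0" "\<And>q. sublinear q \<Longrightarrow> q \<le> p \<Longrightarrow> q = p"
proof -
  let ?A = "{p. sublinear p \<and> p \<le> p0}"
  have "\<exists>m\<in>?A. \<forall>a\<in>?A. a \<le> m \<longrightarrow> a = m"
  proof (rule predicate_Zorn)
    show "partial_order_on ?A (relation_of (\<lambda>p q. q \<le> p) ?A)"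
      by (rule partial_order_on_relation_ofI) auto
  next
    fix C assume C: "C \<in> Chains (relation_of (\<lambda>p q. q \<le> p) ?A)"
    have CA: "sublinear p" "p \<le> p0" if "p \<in> C" for p
      using C that unfolding Chains_def relation_of_def by auto
    have chain: "p \<le> q \<or> q \<le> p" if "p \<in> C" "q \<in> C" for p q
      using C that unfolding Chains_def relation_of_def by auto
    show "\<exists>u\<in>?A. \<forall>a\<in>C. u \<le> a"
    proof (cases "C = {}")
      case True
      then show ?thesis using assms by auto
    next
      case False
      define u where "u = (\<lambda>x. INF p\<in>C. p x)"
      have lower: "u x \<le> p x" if "p \<in> C" for p x
        unfolding u_def using that CA(1) by (intro cINF_lower bdd_belowI2 [where m
            = "- norm x"] sublinear_ge)
      have greatest: "m \<le> u x" if "\<And>p. p \<in> C \<Longrightarrow> m \<le> p x" for m x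
        unfolding u_def using that False by (intro cINF_greatest)
      obtain r where r: "r \<in> C" using False by blast
      have "sublinear u"
        unfolding sublinear_def
      proof (intro conjI allI impI)
        fix x y
        \<comment> \<open>The smaller of \<open>p\<close> and \<open>q\<close> serves for both
          arguments, so its own subadditivity applies.\<close>
        have "u (x + y) \<le> p x + q y" if pq: "p \<in> C" "q \<in> C" for p q
        proof -
          obtain s where "s \<in> C" "s \<le> p" "s \<le> q"
            using chain [OF pq] pq by blast
          moreover have "u (x + y) \<le> s x + s y"
            using lower [OF \<open>s \<in> C\<close>] sublinear_add [OF CA(1) [OF \<open>s \<in> C\<close>]] by (meson order_trans)
          ultimately show ?thesis
            by (smt (verit) le_funD)
        qed
        then have "u (x + y) - q y \<le> u x" if "q \<in> C" for q
          using that by (intro greatest) (simp add: algebra_simps)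
        then have "u (x + y) - u x \<le> u y"
          by (intro greatest) (simp add: algebra_simps)
        then show "u (x + y) \<le> u x + u y" by simp
      next
        fix c x assume c: "0 \<le> (c::real)"
        show "u (c *\<^sub>R x) \<le> c * u x"
        proof (cases "c = 0")
          case True
          then show ?thesis
            using lower [OF r, of 0] sublinear_zero [OF CA(1) [OF r]] by simp
        next
          case False
          have "u (c *\<^sub>R x) / c \<le> u x"
          proof (rule greatest)
            fix p assume p: "p \<in> C"
            show "u (c *\<^sub>R x) / c \<le> p x"
              using lower [OF p, of "c *\<^sub>R x"] sublinear_scaleR [OF CA(1) [OF p] c, of x] c False
              by (simp add: field_simps)
          qed
          then show ?thesis using c False by (simp add: field_simps)
        qed
      next
        fix x
        show "u x \<le> norm x"
          using lower [OF r, of x] sublinear_le_norm [OF CA(1) [OF r], of x] by simp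
      qed
      moreover have "u \<le> p0"
        using lower [OF r] CA(2) [OF r] by (auto simp: le_fun_def intro: order_trans)
      ultimately show ?thesis
        using lower by (intro bexI [of _ u]) (auto simp: le_fun_def)
    qed
  qed
  then show ?thesis
    using that by (metis (mono_tags, lifting) mem_Collect_eq order_trans)
qed

text \<open>Hahn-Banach by minimality: a minimal functional below \<open>tilt norm v\<close> is
  linear, and the tilt at \<open>- v\<close> is at most \<open>norm (- v + v) - norm v\<close>,
  which forces the value \<open>norm v\<close> at \<open>v\<close>.\<close>

lemma norming_functional_exists:
  fixes v :: "'a::real_normed_vector"
  obtains \<Phi> :: "'a \<Rightarrow> real" where "bounded_linear \<Phi>" "\<And>x. \<bar>\<Phi> x\<bar> \<le> norm x" "\<Phi> v = norm v"
proof -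
  obtain p where p: "sublinear p" "p \<le> tilt norm v"
    and min: "\<And>q. sublinear q \<Longrightarrow> q \<le> p \<Longrightarrow> q = p"
    using minimal_sublinear_exists [OF sublinear_tilt [OF sublinear_norm]] by blast
  have add: "p (x + y) = p x + p y" for x y
  proof -
    have "tilt p y \<le> p"
      using tilt_le [OF p(1), of 0 y] by (simp add: le_fun_def)
    then have "tilt p y = p"
      using min sublinear_tilt [OF p(1)] by blast
    then have "p x \<le> p (x + y) - p y"
      using tilt_le [OF p(1), of 1 y x] by simp
    then show ?thesis
      using sublinear_add [OF p(1), of x y] by simp
  qed
  have minus: "p (- x) = - p x" for x
    using add [of x "- x"] sublinear_zero [OF p(1)] by simp
  have pos: "p (c *\<^sub>R x) = c * p x" if "0 \<le> c" for c x
    using sublinear_scaleR [OF p(1) that, of x] sublinear_scaleR [OF p(1) that, of "- x"]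
    by (simp add: minus)
  have scale: "p (c *\<^sub>R x) = c * p x" for c x
  proof (cases "0 \<le> c")
    case False
    then show ?thesis
      using pos [of "- c" x] by (simp add: minus)
  qed (rule pos)
  have bound: "\<bar>p x\<bar> \<le> norm x" for x
    using sublinear_le_norm [OF p(1), of x] sublinear_ge [OF p(1), of x] by simp
  have "p (- v) \<le> - norm v"
    using p(2) tilt_le [OF sublinear_norm, of 1 v "- v"] by (auto simp: le_fun_def intro: order_trans)
  then have "p v = norm v"
    using bound [of v] by (simp add: minus)
  moreover have "bounded_linear p"
    using add scale bound by (intro bounded_linear_intro [where K = 1]) auto
  ultimately show ?thesis
    using that bound by blast
qed

section \<open>Euler splines\<close>

definition alt :: "int \<Rightarrow> real" where
  "alt i = (if even i then 1 else - 1)"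

lemma alt_simps [simp]: "alt 0 = 1" "alt (i + 1) = - alt i" "alt (1 + i) = - alt i" "alt (i - 1) =
    - alt i"
  "alt (i + 2) = alt i" "alt (i - 2) = alt i"
  "\<bar>alt i\<bar> = 1" "alt i * alt i = 1"
  by (auto simp: alt_def)

lemma sin_shift_int_pi: "sin (x + of_int i * pi) = alt i * sin x"
  by (simp add: sin_add alt_def mult.commute)

text \<open>The Fourier series of the Euler spline. At \<open>j = 0\<close> it is the square wave
  \<open>sgn sin\<close>; each integration divides a harmonic by its frequency and delays its phase
  by \<open>pi / 2\<close>.\<close>

definition euler_spline :: "nat \<Rightarrow> real \<Rightarrow> real" where
  "euler_spline j x = 4 / pi * (\<Sum>r. sin (real (2 * r + 1) * x - real j * pi / 2) / real (2 * r
      + 1) ^ (j + 1))"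

text \<open>A point where the spline attains the value \<open>favard j\<close>. It is not reduced
  modulo the period, so it moves by exactly \<open>pi / 2\<close> from \<open>j\<close> to
  \<open>Suc j\<close>.\<close>

definition peak :: "nat \<Rightarrow> real" where
  "peak j = pi / 2 + real j * pi / 2"

text \<open>From \<open>j = 1\<close> on the series has a summable majorant independent of the
  argument, as the Weierstrass test demands; for \<open>j = 0\<close> there is none.\<close>

lemma euler_spline_bound:
  assumes "j \<ge> 1"
  shows "\<bar>sin y / real (2 * r + 1) ^ (j + 1)\<bar> \<le> 1 / real (2 * r + 1) ^ 2"
proof -
  have "real (2 * r + 1) ^ 2 \<le> real (2 * r + 1) ^ (j + 1)"
    using assms by (intro power_increasing) auto
  then have "\<bar>sin y\<bar> / real (2 * r + 1) ^ (j + 1) \<le> 1 / real (2 * r + 1) ^ 2"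
    by (intro frac_le) auto
  then show ?thesis by (simp add: abs_divide)
qed

lemma summable_inverse_odd_squares: "summable (\<lambda>r. 1 / real (2 * r + 1) ^ 2)"
proof (rule summable_comparison_test')
  show "summable (\<lambda>r. inverse (real (Suc r) ^ 2))"
    using inverse_power_summable [of 2, where 'a = real] by (subst summable_Suc_iff) auto
  fix r :: nat assume "r \<ge> 0"
  have "real (Suc r) ^ 2 \<le> real (2 * r + 1) ^ 2"
    by (intro power_mono) auto
  then show "norm (1 / real (2 * r + 1) ^ 2) \<le> inverse (real (Suc r) ^ 2)"
    by (simp add: divide_simps del: power_Suc)
qed

lemma summable_euler_spline:
  assumes "j \<ge> 1"
  shows "summable (\<lambda>r. sin (real (2 * r + 1) * x - real j * pi / 2) / real (2 * r + 1) ^ (j + 1))"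
  using euler_spline_bound [OF assms]
  by (intro summable_comparison_test' [OF summable_inverse_odd_squares]) (simp only: real_norm_def)

text \<open>Only odd harmonics occur, and a shift by \<open>pi\<close> changes the sign of
  each.\<close>

lemma euler_spline_shift_pi:
  assumes "j \<ge> 1"
  shows "euler_spline j (x + pi) = - euler_spline j x"
proof -
  have "sin (real (2 * r + 1) * (x + pi) - real j * pi / 2) = - sin (real (2 * r + 1) * x - real j
      * pi / 2)" for r
  proof -
    have "real (2 * r + 1) * (x + pi) - real j * pi / 2 = (real (2 * r + 1) * x - real j * pi / 2)
        + of_int (2 * int r + 1) * pi"
      by (simp add: algebra_simps)
    then show ?thesis
      by (simp only: sin_shift_int_pi) (simp add: alt_def)
  qed
  then show ?thesis
    using suminf_minus [OF summable_euler_spline [OF assms, of x]] by (simp add: euler_spline_def)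
qed

lemma euler_spline_shift_int_pi:
  assumes "j \<ge> 1"
  shows "euler_spline j (x + of_int i * pi) = alt i * euler_spline j x"
proof (induction i rule: int_induct [where k = 0])
  case (step1 i)
  then show ?case
    using euler_spline_shift_pi [OF assms, of "x + of_int i * pi"] by (simp add: algebra_simps)
next
  case (step2 i)
  then show ?case
    using euler_spline_shift_pi [OF assms, of "x + of_int (i - 1) * pi"] by (simp add: algebra_simps)
qed simp

text \<open>At the peak all phases become \<open>pi / 2\<close> plus a multiple of
  \<open>pi\<close>, so a pure cosine series remains: its value at 0 is the Favard constant, and it
  is even.\<close>

lemma euler_spline_peak_plus:
  "euler_spline j (peak j + x) =
     4 / pi * (\<Sum>r. (- 1) ^ (r * (j + 1)) * cos (real (2 * r + 1) * x) / real (2 * r + 1) ^ (j + 1))"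
proof -
  have sin_cos: "sin (pi / 2 + (u + real m * pi)) = (- 1) ^ m * cos u" for u m
    by (simp add: sin_add cos_add)
  have "sin (real (2 * r + 1) * (peak j + x) - real j * pi / 2) = (- 1) ^ (r * (j + 1))
      * cos (real (2 * r + 1) * x)" for r
  proof -
    have "real (2 * r + 1) * (peak j + x) - real j * pi / 2 = pi / 2 + (real (2 * r + 1) * x
        + real (r * (j + 1)) * pi)"
      by (simp add: peak_def field_simps)
    then show ?thesis
      by (simp only: sin_cos)
  qed
  then show ?thesis by (simp add: euler_spline_def)
qed

lemma euler_spline_peak: "euler_spline j (peak j) = favard j"
  using euler_spline_peak_plus [of j 0] by (simp add: favard_def)

lemma euler_spline_even: "euler_spline j (peak j - x) = euler_spline j (peak j + x)"
  using euler_spline_peak_plus [of j x] euler_spline_peak_plus [of j "- x"] by simp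

lemma favard_0: "favard 0 = 1"
  using pi_series by (simp add: favard_def mult.commute)

section \<open>Differentiating the splines, down to the square wave\<close>

lemma DERIV_euler_spline_Suc:
  assumes "j \<ge> 1"
  shows "(euler_spline (Suc j) has_real_derivative euler_spline j x) (at x)"
proof -
  let ?f = "\<lambda>j r x. sin (real (2 * r + 1) * x - real j * pi / 2) / real (2 * r + 1) ^ (j + 1)"
  have "(?f (Suc j) r has_real_derivative ?f j r x) (at x within UNIV)" for r x
  proof -
    have "real (2 * r + 1) * x - real (Suc j) * pi / 2 = (real (2 * r + 1) * x - real j * pi / 2)
        - pi / 2"
      by (simp add: field_simps)
    then have "cos (real (2 * r + 1) * x - real (Suc j) * pi / 2) = sin (real (2 * r + 1) * x
        - real j * pi / 2)"
      by (simp only: cos_diff) simp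
    then show ?thesis
      by (auto intro!: derivative_eq_intros simp: divide_simps simp del: of_nat_Suc of_nat_add
          of_nat_mult)
  qed
  moreover have "uniformly_convergent_on UNIV (\<lambda>n x. \<Sum>r<n. ?f j r x)"
    using euler_spline_bound [OF assms]
    by (intro Weierstrass_m_test' [OF _ summable_inverse_odd_squares]) (simp only: real_norm_def)
  moreover have "summable (\<lambda>r. ?f (Suc j) r 0)"
    by (rule summable_euler_spline) simp
  ultimately have "((\<lambda>x. \<Sum>r. ?f (Suc j) r x) has_real_derivative (\<Sum>r. ?f j r x)) (at x)"
    by (rule has_field_derivative_series'(2) [OF convex_UNIV _ _ UNIV_I]) simp
  then show ?thesis
    unfolding euler_spline_def [abs_def] by (rule DERIV_cmult)
qed

lemma sum_cos_odd: "2 * sin x * (\<Sum>r<N. cos (real (2 * r + 1) * x)) = sin (real (2 * N) * x)"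
proof (induction N)
  case (Suc N)
  have "real (2 * Suc N) * x = real (2 * N + 1) * x + x" "real (2 * N) * x = real (2 * N + 1) * x - x"
    by (simp_all add: algebra_simps)
  then have "sin (real (2 * Suc N) * x) = sin (real (2 * N) * x) + 2 * sin x * cos (real (2 * N + 1)
      * x)"
    by (simp only: sin_add sin_diff) (simp add: algebra_simps)
  then show ?case
    using Suc by (simp add: algebra_simps)
qed simp

text \<open>Adding \<open>cos (2 N t) / (4 N sin t)\<close> to the partial sum cancels the main term of its derivative
  \<open>sin (2 N t) / (2 sin t)\<close> and leaves one of order \<open>1 / N\<close>.\<close>

lemma square_wave_partial_sums:
  assumes x: "a \<le> x" "x \<le> b" and ab: "a \<le> pi / 2" "pi / 2 \<le> b"
    and d: "d > 0" "\<And>t. a \<le> t \<Longrightarrow> t \<le> b \<Longrightarrow> d \<le> sin t" and N: "N > 0"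
  shows "\<bar>(\<Sum>r<N. sin (real (2 * r + 1) * x) / real (2 * r + 1)) -
      (\<Sum>r<N. sin (real (2 * r + 1) * (pi / 2)) / real (2 * r + 1))\<bar>
    \<le> ((b - a) / (4 * d ^ 2) + 1 / (2 * d)) / real N"
proof -
  define T where "T t = (\<Sum>r<N. sin (real (2 * r + 1) * t) / real (2 * r + 1))" for t
  define R where "R t = cos (real (2 * N) * t) / (4 * real N * sin t)" for t
  have sin_pos: "sin t > 0" if "a \<le> t" "t \<le> b" for t
    using d that by fastforce
  have T': "(T has_real_derivative (\<Sum>r<N. cos (real (2 * r + 1) * t))) (at t)" for t
    unfolding T_def [abs_def]
    by (auto intro!: derivative_eq_intros sum.cong simp: divide_simps simp del: of_nat_Suc
        of_nat_add of_nat_mult)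
  have H': "((\<lambda>t. T t + R t) has_real_derivative - (cos (real (2 * N) * t) * cos t) / (4 * real N
      * (sin t)\<^sup>2)) (at t)"
    if "a \<le> t" "t \<le> b" for t
  proof -
    have "(R has_real_derivative - sin (real (2 * N) * t) / (2 * sin t)
         - (cos (real (2 * N) * t) * cos t) / (4 * real N * (sin t)\<^sup>2)) (at t)"
      unfolding R_def [abs_def] using sin_pos [OF that] N
      by (auto intro!: derivative_eq_intros simp: field_simps power2_eq_square)
    from DERIV_add [OF T' this] show ?thesis
      using sum_cos_odd [of t N] sin_pos [OF that] by (simp add: field_simps)
  qed
  have "norm ((T x + R x) - (T (pi / 2) + R (pi / 2))) \<le> 1 / (4 * real N * d\<^sup>2) * norm (x - pi / 2)"
  proof (rule field_differentiable_bound [where S = "{a..b}"])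
    fix t assume "t \<in> {a..b}"
    then have t: "a \<le> t" "t \<le> b" by auto
    show "((\<lambda>t. T t + R t) has_real_derivative - (cos (real (2 * N) * t) * cos t) / (4 * real N
        * (sin t)\<^sup>2)) (at t within {a..b})"
      using H' [OF t] by (rule has_field_derivative_at_within)
    have "\<bar>cos (real (2 * N) * t) * cos t\<bar> \<le> 1"
      unfolding abs_mult by (intro mult_le_one) auto
    moreover have "d\<^sup>2 \<le> (sin t)\<^sup>2"
      using d(1) d(2) [OF t] by (intro power_mono) auto
    ultimately have "\<bar>cos (real (2 * N) * t) * cos t\<bar> / (4 * real N * (sin t)\<^sup>2) \<le> 1 / (4 * real N
        * d\<^sup>2)"
      using N d(1) by (intro frac_le) auto
    then show "norm (- (cos (real (2 * N) * t) * cos t) / (4 * real N * (sin t)\<^sup>2)) \<le> 1 / (4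
        * real N * d\<^sup>2)"
      by (simp add: abs_divide abs_mult)
  qed (use x ab in auto)
  also have "\<dots> \<le> 1 / (4 * real N * d\<^sup>2) * (b - a)"
    using x ab by (intro mult_left_mono) auto
  finally have 1: "\<bar>(T x + R x) - (T (pi / 2) + R (pi / 2))\<bar> \<le> (b - a) / (4 * d\<^sup>2) / real N"
    by (simp add: field_simps)
  have R: "\<bar>R t\<bar> \<le> 1 / (4 * real N * d)" if "a \<le> t" "t \<le> b" for t
  proof -
    have "\<bar>cos (real (2 * N) * t)\<bar> / (4 * real N * sin t) \<le> 1 / (4 * real N * d)"
      using N d(1) d(2) [OF that] by (intro frac_le) auto
    then show ?thesis
      using sin_pos [OF that] by (simp add: R_def abs_divide abs_mult)
  qed
  have "1 / (4 * real N * d) + 1 / (4 * real N * d) = 1 / (2 * d) / real N"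
    using N d(1) by (simp add: field_simps)
  then have "\<bar>T x - T (pi / 2)\<bar> \<le> (b - a) / (4 * d\<^sup>2) / real N + 1 / (2 * d) / real N"
    using 1 R [OF x] R [OF ab] by linarith
  then show ?thesis
    by (simp add: T_def add_divide_distrib)
qed

text \<open>The differentiated series lacks a summable majorant. It still converges uniformly on
  compact parts of \<open>(0, pi)\<close>, because its partial sums are within order
  \<open>1 / N\<close> of those at \<open>pi / 2\<close>, where Leibniz' series gives
  \<open>pi / 4\<close>.\<close>

lemma DERIV_euler_spline_1_pos:
  assumes "0 < x" "x < pi"
  shows "(euler_spline 1 has_real_derivative 1) (at x)"
proof -
  \<comment> \<open>The interval from \<open>a\<close> to \<open>b\<close> contains \<open>x\<close>
    in its interior and the reference point \<open>pi / 2\<close>, and stays off the zeros of the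
    sine.\<close>
  define a where "a = min x (pi / 2) / 2"
  define b where "b = (max x (pi / 2) + pi) / 2"
  have ab: "0 < a" "a < x" "x < b" "b < pi" "a < pi / 2" "pi / 2 < b"
    using assms by (auto simp: a_def b_def min_def max_def field_simps)
  have "compact {a..b}" "{a..b} \<noteq> {}" using ab by auto
  then obtain t0 where t0: "t0 \<in> {a..b}" "\<And>t. t \<in> {a..b} \<Longrightarrow> sin t0 \<le> sin t"
    using continuous_attains_inf [of "{a..b}" sin] continuous_on_sin [OF continuous_on_id, of
        "{a..b}"] by blast
  have d: "sin t0 > 0" using t0(1) ab by (intro sin_gt_zero) auto
  let ?T = "\<lambda>N x. \<Sum>r<N. sin (real (2 * r + 1) * x) / real (2 * r + 1)"
  have leibniz: "(\<lambda>N. ?T N (pi / 2)) \<longlonglongrightarrow> pi / 4"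
  proof -
    have "sin (real (2 * r + 1) * (pi / 2)) = (- 1) ^ r" for r
    proof -
      have "real (2 * r + 1) * (pi / 2) = pi / 2 + real r * pi" by (simp add: field_simps)
      then show ?thesis by (simp only: sin_add) simp
    qed
    moreover have "(\<lambda>r. (- 1) ^ r * 1 / real (r * 2 + 1)) sums (pi / 4)"
      unfolding pi_series using summable_arctan_series [of 1] by (intro summable_sums) simp
    ultimately show ?thesis
      by (simp add: sums_def mult.commute)
  qed
  have lim: "uniform_limit {a..b} ?T (\<lambda>_. pi / 4) sequentially"
  proof (rule uniform_limitI)
    fix e :: real assume e: "e > 0"
    have "(\<lambda>N. ((b - a) / (4 * sin t0 ^ 2) + 1 / (2 * sin t0)) / real N) \<longlonglongrightarrow> 0"
      by (rule lim_const_over_n)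
    then have "\<forall>\<^sub>F N in sequentially. ((b - a) / (4 * sin t0 ^ 2) + 1 / (2 * sin t0)) / real N < e / 2"
      using e by (intro order_tendstoD) auto
    moreover have "\<forall>\<^sub>F N in sequentially. dist (?T N (pi / 2)) (pi / 4) < e / 2"
      using leibniz e by (intro tendstoD) auto
    moreover have "\<forall>\<^sub>F N::nat in sequentially. N > 0"
      by (rule eventually_gt_at_top)
    ultimately show "\<forall>\<^sub>F N in sequentially. \<forall>x\<in>{a..b}. dist (?T N x) (pi / 4) < e"
    proof eventually_elim
      case (elim N)
      show ?case
      proof
        fix x assume "x \<in> {a..b}"
        then have "\<bar>?T N x - ?T N (pi / 2)\<bar> \<le> ((b - a) / (4 * sin t0 ^ 2) + 1 / (2 * sin t0)) / real N"
          using ab d t0(2) elim(3) by (intro square_wave_partial_sums) auto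
        then show "dist (?T N x) (pi / 4) < e"
          using elim(1,2) unfolding dist_real_def by linarith
      qed
    qed
  qed
  let ?f = "\<lambda>r x. sin (real (2 * r + 1) * x - real 1 * pi / 2) / real (2 * r + 1) ^ (1 + 1)"
  have x: "x \<in> interior {a..b}"
    using ab by auto
  have "(?f r has_real_derivative sin (real (2 * r + 1) * x) / real (2 * r + 1))
      (at x within {a..b})" for r x
  proof -
    have "cos (real (2 * r + 1) * x - real 1 * pi / 2) = sin (real (2 * r + 1) * x)"
      by (simp only: cos_diff) simp
    then show ?thesis
      by (auto intro!: derivative_eq_intros simp: divide_simps power2_eq_square simp del: of_nat_Suc
          of_nat_add of_nat_mult)
  qed
  moreover have "uniformly_convergent_on {a..b} ?T"
    using lim by (auto simp: uniformly_convergent_on_def)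
  moreover have "x \<in> {a..b}"
    using ab by auto
  moreover have "summable (\<lambda>r. ?f r x)"
    by (rule summable_euler_spline) simp
  ultimately have "((\<lambda>x. \<Sum>r. ?f r x) has_real_derivative (\<Sum>r. sin (real (2 * r + 1) * x) / real (2
      * r + 1))) (at x)"
    by (rule has_field_derivative_series'(2) [OF convex_closed_interval _ _ _ _ x])
  also have "(\<Sum>r. sin (real (2 * r + 1) * x) / real (2 * r + 1)) = pi / 4"
    using tendsto_uniform_limitI [OF lim, of x] ab by (intro sums_unique [symmetric])
        (auto simp: sums_def)
  finally have "((\<lambda>x. 4 / pi * (\<Sum>r. ?f r x)) has_real_derivative 4 / pi * (pi / 4)) (at x)"
    by (rule DERIV_cmult)
  then show ?thesis
    unfolding euler_spline_def [abs_def] by simp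
qed

lemma DERIV_euler_spline_1:
  assumes "sin x \<noteq> 0"
  shows "(euler_spline 1 has_real_derivative sgn (sin x)) (at x)"
proof -
  define i where "i = \<lfloor>x / pi\<rfloor>"
  define y where "y = x - of_int i * pi"
  have x: "x = y + of_int i * pi" by (simp add: y_def)
  have sin_x: "sin x = alt i * sin y"
    unfolding x by (rule sin_shift_int_pi)
  have "y \<noteq> 0" using assms sin_x by auto
  moreover have "of_int i \<le> x / pi" "x / pi < of_int i + 1"
    unfolding i_def by linarith+
  ultimately have y: "0 < y" "y < pi"
    by (auto simp: y_def field_simps)
  have "((\<lambda>z. euler_spline 1 (z - of_int i * pi)) has_real_derivative 1 * 1) (at x)"
    by (rule DERIV_chain2 [where f = "euler_spline 1"]) (use DERIV_euler_spline_1_pos [OF y] in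
        \<open>auto simp: y_def intro!: derivative_eq_intros\<close>)
  then have "((\<lambda>z. alt i * euler_spline 1 (z - of_int i * pi)) has_real_derivative alt i * (1 * 1))
      (at x)"
    by (rule DERIV_cmult)
  moreover have "alt i * euler_spline 1 (z - of_int i * pi) = euler_spline 1 z" for z
    using euler_spline_shift_int_pi [of 1 "z - of_int i * pi" i] by simp
  moreover have "sgn (sin x) = alt i"
    using sin_gt_zero [OF y] by (simp add: sin_x alt_def)
  ultimately show ?thesis by simp
qed

lemma isCont_euler_spline:
  assumes "j \<ge> 1"
  shows "isCont (euler_spline j) x"
proof -
  let ?f = "\<lambda>r x. sin (real (2 * r + 1) * x - real j * pi / 2) / real (2 * r + 1) ^ (j + 1)"
  have "norm (?f r x) \<le> 1 / real (2 * r + 1) ^ 2" for r x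
    unfolding real_norm_def using assms by (rule euler_spline_bound)
  then have "uniform_limit UNIV (\<lambda>n x. \<Sum>r<n. ?f r x) (\<lambda>x. \<Sum>r. ?f r x) sequentially"
    using summable_inverse_odd_squares by (rule Weierstrass_m_test)
  moreover have "continuous_on UNIV (?f r)" for r
    by (auto intro!: continuous_intros simp del: of_nat_Suc of_nat_add of_nat_mult)
  then have "\<forall>\<^sub>F n in sequentially. continuous_on UNIV (\<lambda>x. \<Sum>r<n. ?f r x)"
    by (intro always_eventually allI continuous_on_sum)
  ultimately have "continuous_on UNIV (\<lambda>x. \<Sum>r. ?f r x)"
    by (intro uniform_limit_theorem [OF _ _ trivial_limit_sequentially])
  then have "continuous_on UNIV (euler_spline j)"
    unfolding euler_spline_def [abs_def] by (rule continuous_on_mult_left)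
  then show ?thesis
    by (simp add: continuous_on_eq_continuous_at)
qed

section \<open>Monotone branches and extreme values of the splines\<close>

lemma euler_spline_increasing:
  assumes "\<And>x. - pi < x \<Longrightarrow> x < 0 \<Longrightarrow> \<exists>y. DERIV (\<lambda>x. euler_spline j (peak j + x)) x :> y \<and> y > 0"
    and "j \<ge> 1" "- pi \<le> x" "x < y" "y \<le> 0"
  shows "euler_spline j (peak j + x) < euler_spline j (peak j + y)"
proof (rule DERIV_pos_imp_increasing_open [OF \<open>x < y\<close>])
  have "isCont (\<lambda>x. euler_spline j (peak j + x)) t" for t
    using isCont_euler_spline [OF assms(2)] by (rule isCont_o2 [rotated]) (intro continuous_intros)
  then show "continuous_on {x..y} (\<lambda>x. euler_spline j (peak j + x))"
    by (simp add: continuous_at_imp_continuous_on)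
qed (use assms in auto)

text \<open>Induction on \<open>j\<close>: the spline rises from \<open>peak j - pi\<close> to
  \<open>peak j\<close> and vanishes halfway, so by evenness it is positive within
  \<open>pi / 2\<close> of its peak. It is the derivative of the next spline, whose rising branch
  lies exactly there.\<close>

lemma euler_spline_unimodal:
  assumes "j \<ge> 1"
  shows "- pi < x \<Longrightarrow> x < 0 \<Longrightarrow> \<exists>y. DERIV (\<lambda>x. euler_spline j (peak j + x)) x :> y \<and> y > 0"
  using assms
proof (induction j arbitrary: x rule: dec_induct)
  case base
  have s: "sin (peak 1 + x) = - sin x" by (simp add: peak_def sin_add)
  have "sin x < 0"
    using sin_gt_zero [of "- x"] base by simp
  then have "((\<lambda>x. euler_spline 1 (peak 1 + x)) has_real_derivative 1 * 1) (at x)"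
    using DERIV_euler_spline_1 [of "peak 1 + x"] s
    by (intro DERIV_chain2 [where f = "euler_spline 1"]) (auto intro!: derivative_eq_intros)
  then show ?case by auto
next
  case (step j)
  note inc = euler_spline_increasing [OF step.IH \<open>1 \<le> j\<close>]
  have "peak j - pi / 2 + pi = peak j + pi / 2"
    by simp
  then have "euler_spline j (peak j + pi / 2) = - euler_spline j (peak j - pi / 2)"
    using euler_spline_shift_pi [OF \<open>1 \<le> j\<close>] by metis
  then have zero: "euler_spline j (peak j - pi / 2) = 0"
    using euler_spline_even [of j "pi / 2"] by simp
  have pos: "euler_spline j (peak j + t) > 0" if "- pi / 2 < t" "t < pi / 2" for t
  proof -
    have "euler_spline j (peak j + - \<bar>t\<bar>) > 0"
      using inc [of "- pi / 2" "- \<bar>t\<bar>"] zero that by (simp add: abs_if split: if_splits)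
    then show ?thesis
      using euler_spline_even [of j t] by (cases "t \<ge> 0") auto
  qed
  have "((\<lambda>x. euler_spline (Suc j) (peak (Suc j) + x)) has_real_derivative euler_spline j (peak (Suc
      j) + x) * 1) (at x)"
    using DERIV_euler_spline_Suc [OF \<open>1 \<le> j\<close>]
    by (intro DERIV_chain2 [where f = "euler_spline (Suc j)"]) (auto intro!: derivative_eq_intros)
  moreover have "peak (Suc j) + x = peak j + (x + pi / 2)"
    by (simp add: peak_def field_simps)
  ultimately show ?case
    using pos [of "x + pi / 2"] step.prems by auto
qed

lemma
  assumes "j \<ge> 1"
  shows favard_pos: "favard j > 0" and abs_euler_spline_le: "\<bar>euler_spline j x\<bar> \<le> favard j"
proof -
  note inc = euler_spline_increasing [OF euler_spline_unimodal [OF assms] assms]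
  have neg: "euler_spline j (peak j - pi) = - favard j"
    using euler_spline_shift_pi [OF assms, of "peak j - pi"] by (simp add: euler_spline_peak)
  show "favard j > 0"
    using inc [of "- pi" 0] neg by (simp add: euler_spline_peak)
  \<comment> \<open>Reduction to the rising branch that ends at the peak. The floor alone would put
    \<open>y\<close> into \<open>[0, pi)\<close>, so one further \<open>pi\<close> is
    subtracted.\<close>
  define y where "y = (x - peak j) - of_int (\<lfloor>(x - peak j) / pi\<rfloor> + 1) * pi"
  have fl: "of_int \<lfloor>(x - peak j) / pi\<rfloor> \<le> (x - peak j) / pi"
    "(x - peak j) / pi < of_int \<lfloor>(x - peak j) / pi\<rfloor> + 1" by linarith+
  have y: "- pi \<le> y" "y < 0"
    using fl(1) [unfolded pos_le_divide_eq [OF pi_gt_zero]] fl(2) [unfolded pos_divide_less_eq [OF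
        pi_gt_zero]]
    unfolding y_def by (simp_all only: of_int_add of_int_1 distrib_right mult_1)
  have "\<bar>euler_spline j x\<bar> = \<bar>euler_spline j (peak j + y)\<bar>"
    using euler_spline_shift_int_pi [OF assms, of "peak j + y" "\<lfloor>(x - peak j) / pi\<rfloor> + 1"]
    by (simp add: y_def abs_mult)
  also have "\<dots> \<le> favard j"
    using inc [of y 0] inc [of "- pi" y] y neg by (cases "y = - pi") (auto simp: euler_spline_peak)
  finally show "\<bar>euler_spline j x\<bar> \<le> favard j" .
qed

lemma euler_spline_peak_shift:
  assumes "j \<ge> 1"
  shows "euler_spline j (peak j + of_int i * pi) = alt i * favard j"
  using euler_spline_shift_int_pi [OF assms, of "peak j" i] by (simp add: euler_spline_peak)

section \<open>Kolmogorov's comparison for scalar functions\<close>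

text \<open>The peaks of \<open>euler_spline j\<close> on the left are continued on the right with an index shift
  by two: \<open>h\<close> has two more sign changes than the spline.\<close>

definition alternates :: "nat \<Rightarrow> (real \<Rightarrow> real) \<Rightarrow> bool" where
  "alternates j h \<longleftrightarrow>
     (\<exists>x :: int \<Rightarrow> real. (\<forall>i. x i < x (i + 1)) \<and> (\<forall>i. 0 < alt i * h (x i)) \<and>
       (\<exists>M. (\<forall>i < - M. x i = peak j + of_int i * pi) \<and> (\<forall>i>M. x i = peak j + of_int (i - 2) * pi)))"

text \<open>The increment of \<open>h\<close> between consecutive points has the sign of
  \<open>h\<close> at the right one, and the mean value theorem passes it on to the derivative. Far
  out the new points are the peaks of \<open>euler_spline j\<close>, where the decaying
  \<open>G\<close> cannot change the sign.\<close>

lemma alternates_deriv: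
  assumes j: "j \<ge> 1" and h: "alternates (Suc j) h"
    and deriv: "\<And>x. (h has_real_derivative euler_spline j x - G x) (at x)"
    and lim: "(G \<longlongrightarrow> 0) at_infinity"
  shows "alternates j (\<lambda>x. euler_spline j x - G x)"
proof -
  obtain x M where inc: "\<And>i. x i < x (i + 1)" and pos: "\<And>i. 0 < alt i * h (x i)"
    and left: "\<And>i. i < - M \<Longrightarrow> x i = peak (Suc j) + of_int i * pi"
    and right: "\<And>i. i > M \<Longrightarrow> x i = peak (Suc j) + of_int (i - 2) * pi"
    using h unfolding alternates_def by metis
  obtain B where B: "\<And>x. B \<le> \<bar>x\<bar> \<Longrightarrow> \<bar>G x\<bar> < favard j"
    using lim favard_pos [OF j] unfolding Lim_at_infinity by auto
  have tail_pos: "0 < alt i * (euler_spline j (peak j + of_int k * pi) - G (peak j + of_int k * pi))"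
    if "alt k = alt i" "B + \<bar>peak j\<bar> \<le> \<bar>of_int k\<bar>" for i k
  proof -
    have "\<bar>of_int k :: real\<bar> * 1 \<le> \<bar>of_int k\<bar> * pi"
      using pi_gt3 by (intro mult_left_mono) auto
    then have "\<bar>of_int k\<bar> \<le> \<bar>of_int k * pi\<bar>"
      by (simp add: abs_mult)
    then have "\<bar>G (peak j + of_int k * pi)\<bar> < favard j"
      using that(2) by (intro B) linarith
    then show ?thesis
      unfolding euler_spline_peak_shift [OF j] that(1) by (auto simp: alt_def)
  qed
  \<comment> \<open>Beyond \<open>M'\<close> both \<open>i\<close> and \<open>i - 1\<close> lie in
    the old tails, and the peaks with index \<open>i\<close>, or \<open>i - 2\<close> on the right,
    are at least \<open>B\<close> away from 0. The maximum with 0 keeps the two tails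
    disjoint.\<close>
  define M' where "M' = max (max 0 (M + 1)) (\<lceil>B + \<bar>peak j\<bar>\<rceil> + 2)"
  have peak_Suc: "peak (Suc j) = peak j + pi / 2"
    by (simp add: peak_def field_simps)
  have "\<exists>y. x (i - 1) < y \<and> y < x i \<and> 0 < alt i * (euler_spline j y - G y) \<and>
      (i < - M' \<longrightarrow> y = peak j + of_int i * pi) \<and> (i > M' \<longrightarrow> y = peak j + of_int (i - 2) * pi)" for i
  proof -
    have M': "0 \<le> M'" "M + 1 \<le> M'" "of_int M' \<ge> B + \<bar>peak j\<bar> + 2"
      unfolding M'_def by linarith+
    consider "i < - M'" | "i > M'" "\<not> i < - M'" | "\<not> i < - M'" "\<not> i > M'" by blast
    then show ?thesis
    proof cases
      case 1
      have x: "x (i - 1) = peak j + pi / 2 + of_int (i - 1) * pi" "x i = peak j + pi / 2 + of_int i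
          * pi"
        using 1 M' left [of i] left [of "i - 1"] by (simp_all add: peak_Suc)
      have "B + \<bar>peak j\<bar> \<le> \<bar>of_int i\<bar>"
        using 1 M' by linarith
      moreover have "\<not> i > M'"
        using 1 M' by linarith
      moreover have "x (i - 1) < peak j + of_int i * pi" "peak j + of_int i * pi < x i"
        unfolding x using pi_gt_zero by (simp_all add: algebra_simps)
      ultimately show ?thesis
        using 1 tail_pos [of i i] by blast
    next
      case 2
      have x: "x (i - 1) = peak j + pi / 2 + of_int (i - 3) * pi" "x i = peak j + pi / 2 + of_int (i
          - 2) * pi"
        using 2 M' right [of i] right [of "i - 1"] by (simp_all add: peak_Suc)
      have "B + \<bar>peak j\<bar> \<le> \<bar>of_int (i - 2)\<bar>"
        using 2 M' by linarith
      moreover have "x (i - 1) < peak j + of_int (i - 2) * pi" "peak j + of_int (i - 2) * pi < x i"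
        unfolding x using pi_gt_zero by (simp_all add: algebra_simps)
      ultimately show ?thesis
        using 2 tail_pos [of "i - 2" i] by (metis alt_simps(6))
    next
      case 3
      have lt: "x (i - 1) < x i"
        using inc [of "i - 1"] by simp
      then obtain z where z: "x (i - 1) < z" "z < x i"
        and eq: "h (x i) - h (x (i - 1)) = (x i - x (i - 1)) * (euler_spline j z - G z)"
        using MVT2 [OF lt deriv] by blast
      have "0 < alt i * (h (x i) - h (x (i - 1)))"
        using pos [of i] pos [of "i - 1"] by (simp add: right_diff_distrib)
      also have "\<dots> = (x i - x (i - 1)) * (alt i * (euler_spline j z - G z))"
        by (simp add: eq)
      finally have "0 < alt i * (euler_spline j z - G z)"
        using lt by (simp add: zero_less_mult_iff)
      then show ?thesis
        using z 3 by blast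
    qed
  qed
  then obtain y where y: "\<And>i. x (i - 1) < y i" "\<And>i. y i < x i"
      "\<And>i. 0 < alt i * (euler_spline j (y i) - G (y i))"
      "\<And>i. i < - M' \<Longrightarrow> y i = peak j + of_int i * pi"
      "\<And>i. i > M' \<Longrightarrow> y i = peak j + of_int (i - 2) * pi"
    by metis
  have "y i < y (i + 1)" for i
    using y(2) [of i] y(1) [of "i + 1"] by simp
  then show ?thesis
    unfolding alternates_def using y by blast
qed

text \<open>Since \<open>G'\<close> stays below 1 in size, the derivative of the difference has the
  sign of the sine where the latter is nonzero. So the sine would alternate as well, with more zeros
  than the fixed tails leave room for.\<close>

lemma not_alternates_1:
  assumes deriv: "\<And>x. (G has_real_derivative G' x) (at x)" and small: "\<And>x. \<bar>G' x\<bar> < 1"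
  shows "\<not> alternates 1 (\<lambda>x. euler_spline 1 x - G x)"
proof
  assume "alternates 1 (\<lambda>x. euler_spline 1 x - G x)"
  then obtain x M where inc: "\<And>i. x i < x (i + 1)"
    and pos: "\<And>i. 0 < alt i * (euler_spline 1 (x i) - G (x i))"
    and left: "\<And>i. i < - M \<Longrightarrow> x i = peak 1 + of_int i * pi"
    and right: "\<And>i. i > M \<Longrightarrow> x i = peak 1 + of_int (i - 2) * pi"
    unfolding alternates_def by metis
  have "\<exists>z. x (i - 1) < z \<and> z < x i \<and> 0 < alt i * sin z" for i
  proof (rule ccontr)
    assume "\<not> ?thesis"
    then have neg: "alt i * sin z \<le> 0" if "x (i - 1) < z" "z < x i" for z
      using that by force
    \<comment> \<open>An interior zero would be a local maximum of \<open>alt i * sin\<close>, so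
      the cosine would vanish too. Hence the spline is differentiable on the whole open
      interval.\<close>
    have sin0: "sin z \<noteq> 0" if z: "x (i - 1) < z" "z < x i" for z
    proof
      assume s: "sin z = 0"
      have "((\<lambda>z. alt i * sin z) has_real_derivative alt i * cos z) (at z)"
        by (auto intro!: derivative_eq_intros)
      moreover have "0 < min (z - x (i - 1)) (x i - z)"
        using z by simp
      moreover have "\<forall>y. \<bar>z - y\<bar> < min (z - x (i - 1)) (x i - z) \<longrightarrow> alt i * sin y \<le> alt i * sin z"
        using neg s by (auto simp: abs_less_iff)
      ultimately have "alt i * cos z = 0"
        by (rule DERIV_local_max)
      then have "cos z = 0"
        by (auto simp: alt_def split: if_splits)
      then show False
        using s sin_cos_squared_add [of z] by simp
    qed
    let ?h = "\<lambda>z. alt i * (euler_spline 1 z - G z)"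
    have lt: "x (i - 1) < x i"
      using inc [of "i - 1"] by simp
    \<comment> \<open>Where the sine has the wrong sign \<open>?h\<close> falls, whereas alternation
      makes it go from a negative to a positive value.\<close>
    then have "?h (x (i - 1)) > ?h (x i)"
    proof (rule DERIV_neg_imp_decreasing_open)
      fix z assume z: "x (i - 1) < z" "z < x i"
      have "(?h has_real_derivative alt i * (sgn (sin z) - G' z)) (at z)"
        by (intro DERIV_cmult DERIV_diff DERIV_euler_spline_1 sin0 z deriv)
      moreover have "alt i * (sgn (sin z) - G' z) < 0"
        using neg [OF z] sin0 [OF z] small [of z] by (auto simp: alt_def sgn_if split: if_splits)
      ultimately show "\<exists>y. DERIV ?h z :> y \<and> y < 0" by blast
    next
      have "isCont ?h z" for z
        using isCont_euler_spline [of 1] DERIV_isCont [OF deriv]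
        by (intro continuous_intros) auto
      then show "continuous_on {x (i - 1)..x i} ?h"
        by (simp add: continuous_at_imp_continuous_on)
    qed
    then show False
      using pos [of i] pos [of "i - 1"] by simp
  qed
  then obtain z where z: "\<And>i. x (i - 1) < z i" "\<And>i. z i < x i" "\<And>i. 0 < alt i * sin (z i)"
    by metis
  have "\<exists>k::int. z i < of_int k * pi \<and> of_int k * pi < z (i + 1)" for i
  proof -
    have le: "z i \<le> z (i + 1)"
      using z(2) [of i] z(1) [of "i + 1"] by simp
    have s: "0 < alt i * sin (z i)" "alt i * sin (z (i + 1)) < 0"
      using z(3) [of i] z(3) [of "i + 1"] by auto
    then have "\<exists>t. z i \<le> t \<and> t \<le> z (i + 1) \<and> alt i * sin t = 0"
      using le by (intro IVT2) auto
    then obtain t where t: "z i \<le> t" "t \<le> z (i + 1)" "alt i * sin t = 0" by blast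
    then have "z i \<noteq> t" "t \<noteq> z (i + 1)"
      using s by auto
    moreover have "sin t = 0"
      using t(3) by (auto simp: alt_def split: if_splits)
    then obtain k where "t = of_int k * pi"
      using sin_zero_iff_int2 by blast
    ultimately show ?thesis
      using t by (intro exI [of _ k]) auto
  qed
  then obtain k :: "int \<Rightarrow> int" where k: "\<And>i. z i < of_int (k i) * pi" "\<And>i. of_int (k i) * pi < z (i
      + 1)"
    by metis
  have "k i < k (i + 1)" for i
    using k(2) [of i] k(1) [of "i + 1"] by (metis less_trans mult_less_cancel_right_pos
        of_int_less_iff pi_gt_zero)
  then have grow: "k i + int m \<le> k (i + int m)" for i m
  proof (induction m)
    case (Suc m)
    then show ?case
      using Suc.prems [of "i + int m"] by (simp add: algebra_simps)
  qed simp
  \<comment> \<open>As \<open>peak 1 = pi\<close>, the tails give \<open>x (m + 1) = m * pi\<close>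
    and \<open>x (- m - 1) = - m * pi\<close>. Only \<open>2 * m - 1\<close> multiples of
    \<open>pi\<close> lie strictly between, but \<open>k\<close> has \<open>2 * m + 1\<close>
    distinct values there.\<close>
  define m where "m = \<bar>M\<bar> + 1"
  then have m: "0 \<le> m" "M < m + 1" "- m - 1 < - M" by linarith+
  have "k (- m) + 2 * m \<le> k m"
    using grow [of "- m" "nat (2 * m)"] m(1) by simp
  moreover have "of_int (k m) * pi < of_int m * pi"
  proof -
    have "of_int (k m) * pi < x (m + 1)"
      using k(2) [of m] z(2) [of "m + 1"] by linarith
    also have "\<dots> = of_int m * pi"
      using right [OF m(2)] by (simp add: peak_def algebra_simps)
    finally show ?thesis .
  qed
  then have "k m < m"
    unfolding mult_less_cancel_right_pos [OF pi_gt_zero] of_int_less_iff .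
  moreover have "of_int (- m) * pi < of_int (k (- m)) * pi"
  proof -
    have "of_int (- m) * pi = x (- m - 1)"
      using left [OF m(3)] by (simp add: peak_def algebra_simps)
    also have "\<dots> < of_int (k (- m)) * pi"
      using k(1) [of "- m"] z(1) [of "- m"] by linarith
    finally show ?thesis .
  qed
  then have "- m < k (- m)"
    unfolding mult_less_cancel_right_pos [OF pi_gt_zero] of_int_less_iff .
  ultimately show False
    by linarith
qed

text \<open>Match the values of \<open>G\<close> and of the spline on a rising branch of the spline. If \<open>G\<close> is steeper
  there, the difference changes sign three times on this branch and once on every other one.\<close>

lemma alternates_start:
  assumes n: "n \<ge> 1" and small: "\<And>x. \<bar>G x\<bar> < favard (Suc n)"
    and deriv: "(G has_real_derivative G') (at 0)" and large: "favard n < G'"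
  shows "\<exists>b. alternates (Suc n) (\<lambda>x. euler_spline (Suc n) x - G (x - b))"
proof -
  define q where "q = peak (Suc n)"
  have E: "euler_spline (Suc n) (q + of_int i * pi) = alt i * favard (Suc n)" for i
    unfolding q_def by (rule euler_spline_peak_shift) simp
  have E0: "euler_spline (Suc n) (q - pi) = - favard (Suc n)" "euler_spline (Suc n) q = favard (Suc n)"
    using E [of "- 1"] E [of 0] by (simp_all add: alt_def)
  have "\<exists>b. q - pi \<le> b \<and> b \<le> q \<and> euler_spline (Suc n) b = G 0"
    using small [of 0] E0 isCont_euler_spline [of "Suc n"] by (intro IVT) auto
  then obtain b where "q - pi \<le> b" "b \<le> q" and b: "euler_spline (Suc n) b = G 0" by blast
  then have b': "q - pi < b" "b < q"
    using small [of 0] E0 by (auto simp: less_le)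
  define h where "h x = euler_spline (Suc n) x - G (x - b)" for x
  have "((\<lambda>x. G (x - b)) has_real_derivative G' * 1) (at b)"
    using deriv by (intro DERIV_chain2 [where f = G]) (auto intro!: derivative_eq_intros)
  then have "(h has_real_derivative euler_spline n b - G') (at b)"
    unfolding h_def using DERIV_euler_spline_Suc [OF n] by (intro DERIV_diff) auto
  moreover have "euler_spline n b - G' < 0"
    using abs_euler_spline_le [OF n, of b] large by simp
  ultimately obtain d1 d2 where d: "d1 > 0" "\<And>t. 0 < t \<Longrightarrow> t < d1 \<Longrightarrow> h b < h (b - t)"
      "d2 > 0" "\<And>t. 0 < t \<Longrightarrow> t < d2 \<Longrightarrow> h (b + t) < h b"
    using DERIV_neg_dec_left [of h] DERIV_neg_dec_right [of h] by blast
  \<comment> \<open>At this distance the negative slope of \<open>h\<close> at its zero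
    \<open>b\<close> decides the signs, and both points stay between the peaks \<open>q - pi\<close>
    and \<open>q\<close>.\<close>
  define t where "t = min (min d1 d2) (min (b - (q - pi)) (q - b)) / 2"
  have t: "0 < t" "t < d1" "t < d2" "t < b - (q - pi)" "t < q - b"
    using d(1,3) b' by (auto simp: t_def min_def)
  have "h b = 0" by (simp add: h_def b)
  then have ht: "0 < h (b - t)" "h (b + t) < 0"
    using d t by force+
  \<comment> \<open>The points \<open>b - t\<close> and \<open>b + t\<close> follow the point
    \<open>q - pi\<close> of index \<open>- 1\<close>, so \<open>q\<close> gets index 2 and parities
    are preserved.\<close>
  define x :: "int \<Rightarrow> real" where
    "x i = (if i < 0 then q + of_int i * pi else if i = 0 then b - t else if i = 1 then b + t
            else q + of_int (i - 2) * pi)" for i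
  have "x i < x (i + 1)" for i
  proof -
    consider "i < - 1" | "i = - 1" | "i = 0" | "i = 1" | "i > 1" by linarith
    then show ?thesis
      by cases (use t in \<open>auto simp: x_def algebra_simps\<close>)
  qed
  moreover have "0 < alt i * h (x i)" for i
  proof -
    have ext: "0 < alt i * h (q + of_int k * pi)" if "alt k = alt i" for k
    proof -
      have "h (q + of_int k * pi) = alt i * favard (Suc n) - G (q + of_int k * pi - b)"
        unfolding h_def E that ..
      then show ?thesis
        using small [of "q + of_int k * pi - b"] by (auto simp: alt_def)
    qed
    consider "i < 0" | "i = 0" | "i = 1" | "i > 1" by linarith
    then show ?thesis
      by cases (use ht ext [of i] ext [of "i - 2"] in \<open>auto simp: x_def alt_def\<close>)
  qed
  moreover have "\<forall>i < - 1. x i = q + of_int i * pi" "\<forall>i>1. x i = q + of_int (i - 2) * pi"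
    by (auto simp: x_def)
  ultimately have "alternates (Suc n) h"
    unfolding alternates_def q_def by blast
  then show ?thesis
    unfolding h_def [abs_def] by blast
qed

text \<open>A larger slope would start an alternation at level \<open>n\<close>; differentiating
  \<open>n - 1\<close> times brings it down to level 1, where the bound on \<open>G n\<close> rules
  it out. Decay of the \<open>G i\<close> preserves the tails on the way.\<close>

lemma first_derivative_le_of_decay:
  assumes n: "n \<ge> 2" and deriv: "\<And>i x. (G i has_real_derivative G (Suc i) x) (at x)"
    and lim: "\<And>i. (G i \<longlongrightarrow> 0) at_infinity"
    and G0: "\<And>x. \<bar>G 0 x\<bar> < favard n" and Gn: "\<And>x. \<bar>G n x\<bar> < 1"
  shows "G 1 0 \<le> favard (n - 1)"
proof (rule ccontr)
  assume "\<not> ?thesis"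
  moreover have "Suc (n - 1) = n" "1 \<le> n - 1" using n by auto
  ultimately obtain b where b: "alternates n (\<lambda>x. euler_spline n x - G 0 (x - b))"
    using alternates_start [of "n - 1" "G 0" "G 1 0"] n G0 deriv [of 0 0] by auto
  have deriv': "((\<lambda>x. G i (x - b)) has_real_derivative G (Suc i) (x - b)) (at x)" for i x
  proof -
    have "((\<lambda>x. G i (x - b)) has_real_derivative G (Suc i) (x - b) * 1) (at x)"
      by (rule DERIV_chain2 [OF deriv]) (auto intro!: derivative_eq_intros)
    then show ?thesis by simp
  qed
  have lim': "((\<lambda>x. G i (x - b)) \<longlongrightarrow> 0) at_infinity" for i
  proof (rule filterlim_compose [OF lim])
    show "filterlim (\<lambda>x. x - b) at_infinity at_infinity"
      using tendsto_add_filterlim_at_infinity' [OF filterlim_ident tendsto_const, of "- b"] by simp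
  qed
  have "alternates (n - i) (\<lambda>x. euler_spline (n - i) x - G i (x - b))" if "i \<le> n - 1" for i
    using that
  proof (induction i)
    case (Suc i)
    then have eq: "n - i = Suc (n - Suc i)" and ge: "n - Suc i \<ge> 1"
      using n by auto
    show ?case
    proof (rule alternates_deriv [OF ge])
      show "alternates (Suc (n - Suc i)) (\<lambda>x. euler_spline (n - i) x - G i (x - b))"
        using Suc eq by simp
      show "((\<lambda>x. euler_spline (n - i) x - G i (x - b)) has_real_derivative
          euler_spline (n - Suc i) x - G (Suc i) (x - b)) (at x)" for x
        unfolding eq by (intro DERIV_diff DERIV_euler_spline_Suc ge deriv')
    qed (rule lim')
  qed (use b in simp)
  from this [of "n - 1"] have "alternates 1 (\<lambda>x. euler_spline 1 x - G (n - 1) (x - b))"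
    using n by simp
  moreover have "((\<lambda>x. G (n - 1) (x - b)) has_real_derivative G n (x - b)) (at x)" for x
    using deriv' [of "n - 1" x] n by simp
  ultimately show False
    using not_alternates_1 [of "\<lambda>x. G (n - 1) (x - b)" "\<lambda>x. G n (x - b)"] Gn by blast
qed

section \<open>Products with a decaying cutoff function\<close>

primrec leibniz :: "nat \<Rightarrow> (nat \<Rightarrow> real \<Rightarrow> real) \<Rightarrow> (nat \<Rightarrow> real \<Rightarrow> real) \<Rightarrow> real \<Rightarrow> real" where
  "leibniz 0 g w x = g 0 x * w 0 x"
| "leibniz (Suc m) g w x = leibniz m (\<lambda>i. g (Suc i)) w x + leibniz m g (\<lambda>i. w (Suc i)) x"

text \<open>This is the iterated product rule with equal terms left uncollected,
  \<open>2 ^ m\<close> products in order \<open>m\<close>. Each step shifts one family, so the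
  induction runs over all \<open>g\<close> and \<open>w\<close>.\<close>

lemma DERIV_leibniz:
  assumes "\<And>i x. (g i has_real_derivative g (Suc i) x) (at x)"
    and "\<And>i x. (w i has_real_derivative w (Suc i) x) (at x)"
  shows "(leibniz m g w has_real_derivative leibniz (Suc m) g w x) (at x)"
  using assms
proof (induction m arbitrary: g w)
  case 0
  have "((\<lambda>x. g 0 x * w 0 x) has_real_derivative leibniz (Suc 0) g w x) (at x)"
    using 0 by (auto intro!: derivative_eq_intros)
  then show ?case by simp
next
  case (Suc m)
  have "((\<lambda>x. leibniz m (\<lambda>i. g (Suc i)) w x + leibniz m g (\<lambda>i. w (Suc i)) x) has_real_derivative
      leibniz (Suc m) (\<lambda>i. g (Suc i)) w x + leibniz (Suc m) g (\<lambda>i. w (Suc i)) x) (at x)"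
    by (intro DERIV_add Suc)
  then show ?case by simp
qed

lemma tendsto_leibniz:
  assumes "\<And>i x. \<bar>g i x\<bar> \<le> b i" and "\<And>i. (w i \<longlongrightarrow> 0) F"
  shows "(leibniz m g w \<longlongrightarrow> 0) F"
  using assms
proof (induction m arbitrary: g w b)
  case 0
  have "((\<lambda>x. g 0 x * w 0 x) \<longlongrightarrow> 0) F"
  proof (rule Lim_null_comparison)
    show "\<forall>\<^sub>F x in F. norm (g 0 x * w 0 x) \<le> b 0 * \<bar>w 0 x\<bar>"
      using 0(1) by (intro always_eventually) (auto simp: abs_mult intro: mult_right_mono)
    show "((\<lambda>x. b 0 * \<bar>w 0 x\<bar>) \<longlongrightarrow> 0) F"
      using 0(2) by (intro tendsto_mult_right_zero tendsto_rabs_zero)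
  qed
  then show ?case by simp
next
  case (Suc m)
  have "((\<lambda>x. leibniz m (\<lambda>i. g (Suc i)) w x + leibniz m g (\<lambda>i. w (Suc i)) x) \<longlongrightarrow> 0) F"
    using Suc.prems
    by (intro tendsto_add_zero Suc.IH [of "\<lambda>i. g (Suc i)" "\<lambda>i. b (Suc i)"] Suc.IH [of g b])
  then show ?case by simp
qed

lemma abs_leibniz_le:
  assumes "\<And>i. i \<le> m \<Longrightarrow> \<bar>g i x\<bar> \<le> B" and "\<And>i. i \<le> m \<Longrightarrow> \<bar>w i x\<bar> \<le> W"
  shows "\<bar>leibniz m g w x\<bar> \<le> 2 ^ m * B * W"
  using assms
proof (induction m arbitrary: g w)
  case 0
  then have "\<bar>g 0 x\<bar> * \<bar>w 0 x\<bar> \<le> B * W"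
    by (intro mult_mono) (auto intro: order_trans [OF abs_ge_zero])
  then show ?case by (simp add: abs_mult)
next
  case (Suc m)
  have "\<bar>leibniz m (\<lambda>i. g (Suc i)) w x\<bar> \<le> 2 ^ m * B * W" "\<bar>leibniz m g (\<lambda>i. w (Suc i)) x\<bar> \<le> 2 ^ m
      * B * W"
    using Suc.prems by (intro Suc.IH; simp)+
  then show ?case by simp
qed

text \<open>Every product except \<open>g m x * w 0 x\<close> contains a derivative of
  \<open>w\<close> of order at least one, and is small when these are.\<close>

lemma abs_leibniz_diff_le:
  assumes "\<And>i. i \<le> m \<Longrightarrow> \<bar>g i x\<bar> \<le> B" and "\<And>i. 1 \<le> i \<Longrightarrow> i \<le> m \<Longrightarrow> \<bar>w i x\<bar> \<le> W"
    and "0 \<le> W"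
  shows "\<bar>leibniz m g w x - g m x * w 0 x\<bar> \<le> 2 ^ m * B * W"
  using assms
proof (induction m arbitrary: g)
  case 0
  then have "0 \<le> B" by (metis abs_ge_zero order_trans order_refl)
  then show ?case using 0 by simp
next
  case (Suc m)
  have "\<bar>leibniz m (\<lambda>i. g (Suc i)) w x - g (Suc m) x * w 0 x\<bar> \<le> 2 ^ m * B * W"
    using Suc.prems by (intro Suc.IH) auto
  moreover have "\<bar>leibniz m g (\<lambda>i. w (Suc i)) x\<bar> \<le> 2 ^ m * B * W"
    using Suc.prems by (intro abs_leibniz_le) auto
  ultimately show ?case by simp
qed

text \<open>Derivatives of \<open>1 / cosh\<close>, using \<open>tanh' = 1 - tanh\<^sup>2\<close> and \<open>(1 / cosh)' = - tanh / cosh\<close>.\<close>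

primrec sech_poly :: "nat \<Rightarrow> real poly" where
  "sech_poly 0 = 1"
| "sech_poly (Suc l) = [:1, 0, - 1:] * pderiv (sech_poly l) - [:0, 1:] * sech_poly l"

definition sech_deriv :: "nat \<Rightarrow> real \<Rightarrow> real" where
  "sech_deriv l x = poly (sech_poly l) (tanh x) / cosh x"

lemma DERIV_sech_deriv: "(sech_deriv l has_real_derivative sech_deriv (Suc l) x) (at x)"
proof -
  have "cosh x \<noteq> (0::real)"
    using cosh_real_pos [of x] by simp
  then have "((\<lambda>x. poly (sech_poly l) (tanh x) / cosh x) has_real_derivative
     (poly (pderiv (sech_poly l)) (tanh x) * (1 - tanh x ^ 2) * cosh x - poly (sech_poly l) (tanh x)
         * sinh x) / (cosh x * cosh x)) (at x)"
    by (intro DERIV_divide DERIV_chain2 [OF poly_DERIV]) (auto intro!: derivative_eq_intros)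
  also have "(poly (pderiv (sech_poly l)) (tanh x) * (1 - tanh x ^ 2) * cosh x
      - poly (sech_poly l) (tanh x) * sinh x) / (cosh x * cosh x)
      = sech_deriv (Suc l) x"
    using \<open>cosh x \<noteq> 0\<close> by (simp add: sech_deriv_def tanh_def field_simps power2_eq_square)
  finally show ?thesis
    by (simp add: sech_deriv_def [abs_def])
qed

lemma sech_deriv_bound:
  obtains B where "B > 0" "\<And>x. \<bar>sech_deriv l x\<bar> \<le> B / cosh x"
proof -
  have "compact (poly (sech_poly l) ` {- 1..1})"
    by (intro compact_continuous_image continuous_intros) auto
  then obtain B where B: "B > 0" "\<And>t. t \<in> {- 1..1} \<Longrightarrow> \<bar>poly (sech_poly l) t\<bar> \<le> B"
    using compact_imp_bounded bounded_pos by (metis imageI real_norm_def)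
  have "\<bar>sech_deriv l x\<bar> \<le> B / cosh x" for x
    using B(2) [of "tanh x"] tanh_real_lt_1 [of x] tanh_real_gt_neg1 [of x] cosh_real_pos [of x]
    by (simp add: sech_deriv_def abs_divide divide_right_mono)
  then show ?thesis
    using B(1) that by blast
qed

lemma tendsto_sech_deriv: "(sech_deriv l \<longlongrightarrow> 0) at_infinity"
proof -
  obtain B where B: "B > 0" "\<And>x. \<bar>sech_deriv l x\<bar> \<le> B / cosh x"
    using sech_deriv_bound [of l] by blast
  have "filterlim (cosh :: real \<Rightarrow> real) at_infinity at_infinity"
    by (rule filterlim_at_top_imp_at_infinity, unfold at_infinity_eq_at_top_bot)
      (intro filterlim_sup cosh_real_at_top cosh_real_at_bot)
  then have "((\<lambda>x. B / cosh x) \<longlongrightarrow> 0) at_infinity"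
    by (intro tendsto_divide_0 [OF tendsto_const])
  then show ?thesis
    using B by (intro Lim_null_comparison [where f = "sech_deriv l"]) (auto intro: always_eventually)
qed

text \<open>Take \<open>1 / cosh (s * x)\<close> with small \<open>s\<close>: its
  \<open>i\<close>-th derivative carries the factor \<open>s ^ i\<close>. Being flat at 0 with value
  1, it leaves the first derivative of a product at 0 unchanged.\<close>

lemma cutoff_exists:
  fixes n :: nat and \<epsilon> :: real
  assumes "\<epsilon> > 0"
  obtains w where "w 0 0 = 1" "w 1 0 = 0" "\<And>x. \<bar>w 0 x\<bar> \<le> 1"
    "\<And>i x. (w i has_real_derivative w (Suc i) x) (at x)" "\<And>i. (w i \<longlongrightarrow> 0) at_infinity"
    "\<And>i x. 1 \<le> i \<Longrightarrow> i \<le> n \<Longrightarrow> \<bar>w i x\<bar> \<le> \<epsilon>"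
proof -
  have "\<exists>B>0. \<forall>x. \<bar>sech_deriv l x\<bar> \<le> B" for l
  proof -
    obtain B where B: "B > 0" "\<And>x. \<bar>sech_deriv l x\<bar> \<le> B / cosh x"
      using sech_deriv_bound [of l] by blast
    have "B / cosh x \<le> B" for x
      using B(1) cosh_real_ge_1 [of x] by (simp add: field_simps)
    then show ?thesis using B order_trans by blast
  qed
  then obtain B where B: "\<And>l. B l > 0" "\<And>l x. \<bar>sech_deriv l x\<bar> \<le> B l" by metis
  define W where "W = (\<Sum>l\<le>n. B l)"
  have W: "B l \<le> W" if "l \<le> n" for l
    unfolding W_def using that B(1) by (intro member_le_sum) (auto intro: less_imp_le)
  then have "W > 0" using B(1) [of 0] by (meson le0 less_le_trans)
  define s where "s = min 1 (\<epsilon> / W)"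
  have s: "0 < s" "s \<le> 1" "s * W \<le> \<epsilon>"
    using assms \<open>W > 0\<close> by (auto simp: s_def min_def field_simps)
  define w where "w i x = s ^ i * sech_deriv i (s * x)" for i x
  show ?thesis
  proof
    show "w 0 0 = 1" "w 1 0 = 0"
      by (simp_all add: w_def sech_deriv_def)
    show "\<bar>w 0 x\<bar> \<le> 1" for x
      using cosh_real_ge_1 [of "s * x"] by (simp add: w_def sech_deriv_def)
    show "(w i has_real_derivative w (Suc i) x) (at x)" for i x
    proof -
      have "((\<lambda>x. sech_deriv i (s * x)) has_real_derivative sech_deriv (Suc i) (s * x) * s) (at x)"
        by (rule DERIV_chain2 [OF DERIV_sech_deriv]) (auto intro!: derivative_eq_intros)
      from DERIV_cmult [OF this, of "s ^ i"] show ?thesis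
        by (simp add: w_def [abs_def] mult_ac)
    qed
    show "(w i \<longlongrightarrow> 0) at_infinity" for i
    proof -
      have "filterlim (\<lambda>x. s * x) at_infinity at_infinity"
        using s(1) by (intro tendsto_mult_filterlim_at_infinity [OF tendsto_const] filterlim_ident)
            auto
      from filterlim_compose [OF tendsto_sech_deriv this, of i] show ?thesis
        unfolding w_def [abs_def] by (rule tendsto_mult_right_zero)
    qed
    show "\<bar>w i x\<bar> \<le> \<epsilon>" if "1 \<le> i" "i \<le> n" for i x
    proof -
      have "s ^ i \<le> s ^ 1"
        using s that by (intro power_decreasing) auto
      moreover have "\<bar>sech_deriv i (s * x)\<bar> \<le> W"
        using B(2) W [OF that(2)] order_trans by blast
      ultimately have "s ^ i * \<bar>sech_deriv i (s * x)\<bar> \<le> s * W"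
        using s(1) by (intro mult_mono) auto
      then show ?thesis
        using s by (simp add: w_def abs_mult)
    qed
  qed
qed

text \<open>The cutoff supplies the decay. A factor \<open>\<rho> < 1\<close> makes the bounds
  strict and leaves room for the derivatives of the cutoff; close to 1, it keeps
  \<open>\<rho> * g 1 0\<close> above \<open>favard (n - 1)\<close>.\<close>

lemma kolmogorov_first_derivative:
  assumes n: "n \<ge> 2" and deriv: "\<And>i x. (g i has_real_derivative g (Suc i) x) (at x)"
    and bound: "\<And>i x. \<bar>g i x\<bar> \<le> b i"
    and g0: "\<And>x. \<bar>g 0 x\<bar> \<le> favard n" and gn: "\<And>x. \<bar>g n x\<bar> \<le> 1"
  shows "g 1 0 \<le> favard (n - 1)"
proof (rule ccontr)
  assume large: "\<not> ?thesis"
  have pos: "favard (n - 1) > 0" "favard n > 0"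
    using n by (simp_all add: favard_pos)
  obtain \<rho> where \<rho>: "favard (n - 1) / g 1 0 < \<rho>" "\<rho> < 1"
    using large pos dense [of "favard (n - 1) / g 1 0" 1] by auto
  have \<rho>0: "0 < \<rho>"
    using \<rho>(1) large pos by (meson divide_pos_pos less_trans not_le)
  have b0: "0 \<le> b i" for i
    using bound [of i 0] by linarith
  define B where "B = (\<Sum>i\<le>n. b i)"
  have B: "b i \<le> B" if "i \<le> n" for i
    unfolding B_def using that b0 by (intro member_le_sum) auto
  have "0 \<le> B" using B [of 0] b0 [of 0] by simp
  \<comment> \<open>The error terms of the \<open>n\<close>-th derivative then total less than
    \<open>1 - \<rho>\<close>; the \<open>+ 1\<close> covers \<open>B = 0\<close>.\<close>
  define \<epsilon> where "\<epsilon> = (1 - \<rho>) / (2 ^ n * B + 1)"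
  have den: "0 < 2 ^ n * B + 1"
    using \<open>0 \<le> B\<close> by (simp add: add_nonneg_pos)
  have \<epsilon>: "0 < \<epsilon>" "2 ^ n * B * \<epsilon> < 1 - \<rho>"
    using den \<rho>(2) by (simp_all add: \<epsilon>_def field_simps)
  obtain w where w: "w 0 0 = 1" "w 1 0 = 0" "\<And>x. \<bar>w 0 x\<bar> \<le> 1"
    "\<And>i x. (w i has_real_derivative w (Suc i) x) (at x)" "\<And>i. (w i \<longlongrightarrow> 0) at_infinity"
    "\<And>i x. 1 \<le> i \<Longrightarrow> i \<le> n \<Longrightarrow> \<bar>w i x\<bar> \<le> \<epsilon>"
    using cutoff_exists [OF \<epsilon>(1), of n] by metis
  define g' where "g' i x = \<rho> * g i x" for i x
  have g'_le: "\<bar>g' i x\<bar> \<le> c" if "\<bar>g i x\<bar> \<le> c" for i x c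
    using that \<rho>0 \<rho>(2) mult_mono [of \<rho> 1 "\<bar>g i x\<bar>" c] by (simp add: g'_def abs_mult)
  have "leibniz 1 g' w 0 \<le> favard (n - 1)"
  proof (rule first_derivative_le_of_decay [OF n])
    have "(g' i has_real_derivative g' (Suc i) x) (at x)" for i x
      unfolding g'_def [abs_def] by (intro DERIV_cmult deriv)
    then show "(leibniz i g' w has_real_derivative leibniz (Suc i) g' w x) (at x)" for i x
      using w(4) by (rule DERIV_leibniz)
    show "(leibniz i g' w \<longlongrightarrow> 0) at_infinity" for i
      using g'_le [OF bound] w(5) by (rule tendsto_leibniz)
    show "\<bar>leibniz 0 g' w x\<bar> < favard n" for x
    proof -
      have "\<bar>g 0 x\<bar> * \<bar>w 0 x\<bar> \<le> favard n * 1"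
        using g0 w(3) pos by (intro mult_mono) auto
      then have "\<rho> * (\<bar>g 0 x\<bar> * \<bar>w 0 x\<bar>) \<le> \<rho> * favard n"
        using \<rho>0 by (intro mult_left_mono) auto
      also have "\<dots> < favard n"
        using \<rho>(2) pos by simp
      finally show ?thesis
        using \<rho>0 by (simp add: g'_def abs_mult mult_ac)
    qed
    show "\<bar>leibniz n g' w x\<bar> < 1" for x
    proof -
      have "\<bar>leibniz n g' w x - g' n x * w 0 x\<bar> \<le> 2 ^ n * B * \<epsilon>"
        using w(6) \<epsilon>(1) g'_le [OF order_trans [OF bound B]] by (intro abs_leibniz_diff_le) auto
      moreover have "\<bar>g' n x * w 0 x\<bar> \<le> \<rho> * 1"
        unfolding abs_mult using w(3) gn [of x] \<rho>0
        by (intro mult_mono) (auto simp: g'_def abs_mult intro: mult_left_le)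
      ultimately show ?thesis
        using \<epsilon>(2) by linarith
    qed
  qed
  moreover have "leibniz 1 g' w 0 = \<rho> * g 1 0"
    using w(1,2) by (simp add: g'_def)
  ultimately show False
    using \<rho>(1) large pos by (simp add: field_simps not_le)
qed

section \<open>Isometry groups\<close>

lemma favard_positive: "favard j > 0"
  using favard_0 favard_pos [of j] by (cases j) auto

lemma bounded_linear_C0_isometry_group:
  assumes "C0_isometry_group U"
  shows "bounded_linear (U t)"
proof -
  interpret Vector_Spaces.linear scaleC scaleC "U t"
    using assms by (simp add: C0_isometry_group_def)
  show ?thesis
  proof (rule bounded_linear_intro [where K = 1])
    show "U t (r *\<^sub>R x) = r *\<^sub>R U t x" for r x
      using scale [of "complex_of_real r" x] by (simp add: scaleC_of_real)
    show "norm (U t x) \<le> norm x * 1" for x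
      using assms by (simp add: C0_isometry_group_def)
  qed (rule add)
qed

text \<open>By the group law the difference quotient at \<open>t\<close> is \<open>U t\<close>
  applied to the one at 0, and \<open>U t\<close> and \<open>\<Phi>\<close> are continuous.\<close>

lemma DERIV_functional_orbit:
  assumes U: "C0_isometry_group U" and \<Phi>: "bounded_linear \<Phi>" and f: "f \<in> generator_dom U"
  shows "((\<lambda>t. \<Phi> (U t f)) has_real_derivative \<Phi> (U t (generator U f))) (at t)"
proof -
  note linU = bounded_linear_C0_isometry_group [OF U, of t]
  have "((\<lambda>h. (U h f - f) /\<^sub>R h) \<longlongrightarrow> generator U f) (at 0)"
    using f tendsto_Lim [OF at_neq_bot] unfolding generator_dom_def generator_def by blast
  then have "((\<lambda>h. \<Phi> (U t ((U h f - f) /\<^sub>R h))) \<longlongrightarrow> \<Phi> (U t (generator U f))) (at 0)"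
    by (intro bounded_linear.tendsto [OF \<Phi>] bounded_linear.tendsto [OF linU])
  moreover have "\<Phi> (U t ((U h f - f) /\<^sub>R h)) = (\<Phi> (U (t + h) f) - \<Phi> (U t f)) / h" for h
  proof -
    have "U (t + h) f = U t (U h f)"
      using U by (simp add: C0_isometry_group_def)
    then show ?thesis
      by (simp add: linear_simps [OF linU] linear_simps [OF \<Phi>] divide_inverse mult.commute)
  qed
  ultimately show ?thesis
    by (simp add: DERIV_def)
qed

text \<open>A functional norming \<open>u 1\<close> turns the orbit of \<open>u 0\<close> into a
  scalar function whose first derivative at time 0 is, up to scaling, the norm of
  \<open>u 1\<close>. For \<open>n = 1\<close> the bound on \<open>u n\<close> is the claim, as
  \<open>favard 0 = 1\<close>.\<close>

lemma kolmogorov_first_power: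
  assumes U: "C0_isometry_group U" and dom: "\<And>i. u i \<in> generator_dom U"
    and gen: "\<And>i. generator U (u i) = u (Suc i)"
    and n: "n \<ge> 1" and pos: "a > 0" "l > 0"
    and u0: "norm (u 0) \<le> a * favard n * l ^ n" and un: "norm (u n) \<le> a"
  shows "norm (u 1) \<le> a * favard (n - 1) * l ^ (n - 1)"
proof (cases "n = 1")
  case True
  then show ?thesis using un by (simp add: favard_0)
next
  case False
  with n have n2: "n \<ge> 2" by simp
  obtain \<Phi> where \<Phi>: "bounded_linear \<Phi>" "\<And>x. \<bar>\<Phi> x\<bar> \<le> norm x" "\<Phi> (u 1) = norm (u 1)"
    using norming_functional_exists [of "u 1"] by blast
  \<comment> \<open>Running time at speed \<open>l\<close> multiplies the \<open>i\<close>-th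
    derivative by \<open>l ^ i\<close>; division by \<open>a * l ^ n\<close> turns the bounds on
    \<open>u 0\<close> and \<open>u n\<close> into \<open>favard n\<close> and 1.\<close>
  define c where "c i = l ^ i / (a * l ^ n)" for i
  have c: "c i > 0" "c (Suc i) = c i * l" for i
    using pos by (simp_all add: c_def)
  define g where "g i t = c i * \<Phi> (U (l * t) (u i))" for i t
  have bound: "\<bar>g i t\<bar> \<le> c i * norm (u i)" for i t
  proof -
    have "\<bar>\<Phi> (U (l * t) (u i))\<bar> \<le> norm (u i)"
      using \<Phi>(2) [of "U (l * t) (u i)"] U by (simp add: C0_isometry_group_def)
    then show ?thesis
      using c(1) [of i] by (simp add: g_def abs_mult)
  qed
  have "g 1 0 \<le> favard (n - 1)"
  proof (rule kolmogorov_first_derivative [OF n2 _ bound])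
    show "(g i has_real_derivative g (Suc i) t) (at t)" for i t
    proof -
      have "((\<lambda>t. \<Phi> (U (l * t) (u i))) has_real_derivative \<Phi> (U (l * t) (u (Suc i))) * l) (at t)"
        unfolding gen [symmetric]
        by (rule DERIV_chain2 [OF DERIV_functional_orbit [OF U \<Phi>(1) dom]])
            (auto intro!: derivative_eq_intros)
      from DERIV_cmult [OF this, of "c i"] show ?thesis
        by (simp add: g_def [abs_def] c(2) mult_ac)
    qed
    show "\<bar>g 0 t\<bar> \<le> favard n" for t
    proof -
      have "c 0 * norm (u 0) \<le> c 0 * (a * favard n * l ^ n)"
        using u0 c(1) [of 0] by (intro mult_left_mono) auto
      also have "\<dots> = favard n"
        using pos by (simp add: c_def)
      finally show ?thesis
        using bound [of 0 t] by simp
    qed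
    show "\<bar>g n t\<bar> \<le> 1" for t
    proof -
      have "c n * norm (u n) \<le> c n * a"
        using un c(1) [of n] by (intro mult_left_mono) auto
      also have "\<dots> = 1"
        using pos by (simp add: c_def)
      finally show ?thesis
        using bound [of n t] by simp
    qed
  qed
  moreover have "g 1 0 = c 1 * norm (u 1)"
    using U \<Phi>(3) by (simp add: g_def C0_isometry_group_def)
  moreover have "c 1 = 1 / (a * l ^ (n - 1))"
    using pos n by (cases n) (simp_all add: c_def)
  ultimately have "norm (u 1) / (a * l ^ (n - 1)) \<le> favard (n - 1)"
    by simp
  then have "norm (u 1) \<le> favard (n - 1) * (a * l ^ (n - 1))"
    using pos by (subst (asm) pos_divide_le_eq) auto
  then show ?thesis
    by (simp only: mult_ac)
qed

text \<open>The bound on \<open>u k\<close> is the hypothesis on \<open>u 0\<close> for the sequence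
  shifted by \<open>k\<close> and \<open>n - k\<close> in place of \<open>n\<close>, so each
  application yields the next bound.\<close>

lemma kolmogorov_powers:
  assumes U: "C0_isometry_group U" and dom: "\<And>i. u i \<in> generator_dom U"
    and gen: "\<And>i. generator U (u i) = u (Suc i)"
    and pos: "a > 0" "l > 0"
    and u0: "norm (u 0) \<le> a * favard n * l ^ n" and un: "norm (u n) \<le> a" and "k \<le> n"
  shows "norm (u k) \<le> a * favard (n - k) * l ^ (n - k)"
  using \<open>k \<le> n\<close>
proof (induction k)
  case (Suc k)
  then have "norm (u (1 + k)) \<le> a * favard (n - k - 1) * l ^ (n - k - 1)"
    using un by (intro kolmogorov_first_power [where u = "\<lambda>i. u (i + k)", OF U _ _ _ pos])
      (auto simp: dom gen)
  then show ?case by simp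
qed (use u0 in simp)

lemma kolmogorov_product:
  assumes U: "C0_isometry_group U" and dom: "\<And>i. u i \<in> generator_dom U"
    and gen: "\<And>i. generator U (u i) = u (Suc i)"
    and kn: "k \<le> n" "n \<ge> 1" and a: "a > 0" "norm (u n) \<le> a" and b: "b > 0" "norm (u 0) \<le> b"
  shows "norm (u k) ^ n \<le> favard (n - k) ^ n / favard n ^ (n - k) * a ^ k * b ^ (n - k)"
proof -
  \<comment> \<open>This makes \<open>a * favard n * l ^ n\<close> equal to \<open>b\<close>; the
    \<open>n\<close>-th power taken below removes the root.\<close>
  define l where "l = root n (b / (a * favard n))"
  have l: "l > 0" "l ^ n = b / (a * favard n)"
    using a b kn favard_positive [of n] by (simp_all add: l_def)
  have "norm (u k) \<le> a * favard (n - k) * l ^ (n - k)"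
    using l a b kn favard_positive [of n] by (intro kolmogorov_powers [where u = u, OF U dom gen]) auto
  then have "norm (u k) ^ n \<le> (a * favard (n - k) * l ^ (n - k)) ^ n"
    by (intro power_mono) auto
  also have "\<dots> = a ^ n * favard (n - k) ^ n * (b / (a * favard n)) ^ (n - k)"
    unfolding l(2) [symmetric] by (simp add: power_mult_distrib mult.commute flip: power_mult)
  also have "a ^ n = a ^ k * a ^ (n - k)"
    using kn by (simp flip: power_add)
  also have "a ^ k * a ^ (n - k) * favard (n - k) ^ n * (b / (a * favard n)) ^ (n - k)
      = favard (n - k) ^ n / favard n ^ (n - k) * a ^ k * b ^ (n - k)"
    using a by (simp add: power_divide power_mult_distrib)
  finally show ?thesis .
qed

theorem lemma7p6:
  fixes U :: "real \<Rightarrow> 'a::complex_banach \<Rightarrow> 'a" and D :: "'a \<Rightarrow> 'a" and f :: 'a and k n :: nat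
  assumes "C0_isometry_group U"
    and "D = generator U"
    and "f \<in> smooth_dom (generator_dom U) D"
    and "k \<le> n" and "n \<ge> 1"
  shows "norm ((D ^^ k) f) ^ n
           \<le> favard (n - k) ^ n / favard n ^ (n - k) * norm ((D ^^ n) f) ^ k * norm f ^ (n - k)"
proof -
  have dom: "(D ^^ i) f \<in> generator_dom U" for i
  proof -
    have "f \<in> power_dom (generator_dom U) D (Suc i)"
      using assms(3) unfolding smooth_dom_def by blast
    then show ?thesis by simp
  qed
  have gen: "generator U ((D ^^ i) f) = (D ^^ Suc i) f" for i
    by (simp add: assms(2))
  \<comment> \<open>The norms of \<open>f\<close> and \<open>(D ^^ n) f\<close> may vanish, while
    the product bound needs positive \<open>a\<close> and \<open>b\<close>; so both are enlarged by
    a null sequence and the limit is taken.\<close>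
  let ?e = "\<lambda>m. inverse (real (Suc m))"
  let ?C = "favard (n - k) ^ n / favard n ^ (n - k)"
  have "norm ((D ^^ k) f) ^ n \<le> ?C * (norm ((D ^^ n) f) + ?e m) ^ k * (norm f + ?e m) ^ (n - k)" for m
    using kolmogorov_product [where u = "\<lambda>i. (D ^^ i) f", OF assms(1) dom gen assms(4,5),
        of "norm ((D ^^ n) f) + ?e m" "norm f + ?e m"]
    by (simp add: add_nonneg_pos)
  moreover have "(\<lambda>m. ?C * (norm ((D ^^ n) f) + ?e m) ^ k * (norm f + ?e m) ^ (n - k))
      \<longlonglongrightarrow> ?C * (norm ((D ^^ n) f) + 0) ^ k * (norm f + 0) ^ (n - k)"
    by (intro tendsto_intros LIMSEQ_inverse_real_of_nat)
  ultimately have "norm ((D ^^ k) f) ^ n \<le> ?C * (norm ((D ^^ n) f) + 0) ^ k * (norm f + 0) ^ (n - k)"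
    by (intro LIMSEQ_le_const) auto
  then show ?thesis by simp
qed

end
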